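(* Consider the coupled system $$x^{i}(t+1)=f^{i}_{t}(x^{1}(t),\dots,x^{m}(t)),\qquad i=1,\dots,m,\ t\in\mathbb Z^{+}=\{0,1,2,\dots\},\qquad ( * )$$ where each $f^i_t:\mathbb R^m\to\mathbb R$ is $C^1$. Suppose: (H1) There is a $C^1$ function $f:\mathbb R\to\mathbb R$ with $f^i_t(s,s,\dots,s)=f(s)$ for all $s\in\mathbb R$, $t\in\mathbb Z^+$, $i=1,\dots,m$. Moreover, for any compact $K\subset\mathbb R^m$, the functions $f^i_t$ and the Jacobian matrices $[\partial f^i_t/\partial x^j]_{i,j=1}^m$ are all equicontinuous in $K$ with respect to $t\in\mathbb Z^+$, and the Jacobian matrices are all nonsingular in $K$. (H2) There is a compact asymptotically stable attractor $A\subset\mathbb R$ for $s(t+1)=f(s(t))$ (as defined in the context). (H3) $\sup_{s_0\in A}\operatorname{diam}(\mathcal D,s_0)<1$. Then the compact set $A^m\cap\mathcal S$, where $\mathcal S=\{x\in\mathbb R^m: x^i=x^j,\ i,j=1,\dots,m\}$ and $A^m=A\times\cdots\times A$, is a uniformly asymptotically stable attractor of $( * )$ in $\mathbb R^m$; that is, the coupled system $( * )$ is uniformly locally completely synchronized (both notions as defined in the context).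
   Context: Asymptotically stable attractor for $s(t+1)=f(s(t))$: a compact set $A\subset\mathbb R$ such that (i) $A$ is forward invariant; (ii) for any neighborhood $U$ of $A$ there is a neighborhood $V$ of $A$ with $f^{n}(V)\subset U$ for all $n\in\mathbb Z^+$ ($f^n$ is the $n$-th iterate); (iii) for any sufficiently small neighborhood $U$ of $A$, $f^n(U)$ converges to $A$: for any neighborhood $V$ of $A$ there is $n_0$ with $f^n(U)\subset V$ for $n\ge n_0$; (iv) there is $s^*\in A$ whose $\omega$-limit set is $A$. Hajnal diameter of a matrix: for a real matrix $L$ with rows $g_1,\dots,g_m$ and a fixed vector norm $\|\cdot\|$, $\operatorname{diam}(L)=\max_{i,j}\|g_i-g_j\|$. For a column vector $x=[x^1,\dots,x^m]^\top$ this is $\max_{i,j}|x^i-x^j|$ (with the absolute value as the norm). $\prod$ is the left matrix product: $\prod_{k=a}^{b}A_k=A_bA_{b-1}\cdots A_a$. $D_t(s)$ is the Jacobian matrix $[\partial f^i_t/\partial x^j]_{i,j=1}^m$ evaluated at $(s,\dots,s)$, $f^{(k)}$ is the $k$-th iterate of $f$, and $$\operatorname{diam}(\mathcal D,s_0)=\limsup_{t\to\infty}\ \sup_{t_0\ge 0}\Big\{\operatorname{diam}\Big(\prod_{k=t_0}^{t_0+t-1}D_k(f^{(k-t_0)}(s_0))\Big)\Big\}^{1/t},$$ which does not depend on the norm. Uniformly asymptotically stable attractor: a compact set $K\subset\mathbb R^m$ such that (a) for every $\epsilon>0$ there is $\delta>0$ such that for all $t_0\ge0$, $\operatorname{dist}(x(t_0),K)<\delta$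 implies $\operatorname{dist}(x(t),K)<\epsilon$ for all $t\ge t_0$; and (b) there is $\eta>0$ such that for every $\epsilon>0$ there is $T>0$ such that for all $t_0\ge0$, $\operatorname{dist}(x(t_0),K)<\eta$ implies $\operatorname{dist}(x(t),K)<\epsilon$ for all $t\ge t_0+T$; here $x(t)$ is the solution of the system started at time $t_0$ from $x(t_0)$. (Uniformly locally completely) synchronized: there exists $\eta>0$ such that for any $\epsilon>0$ there exists $T>0$ such that $\operatorname{diam}([x^1(t),\dots,x^m(t)]^\top)\le\epsilon$ for all $t_0\ge0$, all $t>t_0+T$, and all solutions whose initial components $x^i(t_0)$, $i=1,\dots,m$, lie in the $\eta$-neighborhood of the value $s(t_0)\in A$ of a synchronized state $s(t)$ (a solution of $s(t+1)=f(s(t))$). *)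

theory Defs
  imports "HOL-Analysis.Analysis"
begin

definition nbhd_of :: "'a::topological_space set \<Rightarrow> 'a set \<Rightarrow> bool" where
  "nbhd_of A U \<longleftrightarrow> A \<subseteq> interior U"

definition omega_limit_set :: "('a::topological_space \<Rightarrow> 'a) \<Rightarrow> 'a \<Rightarrow> 'a set" where
  "omega_limit_set f s = {y. \<exists>r. strict_mono r \<and> (\<lambda>k. (f ^^ r k) s) \<longlonglongrightarrow> y}"

definition asymptotically_stable_attractor :: "(real \<Rightarrow> real) \<Rightarrow> real set \<Rightarrow> bool" where
  "asymptotically_stable_attractor f A \<longleftrightarrow>
     compact A \<and>
     f ` A \<subseteq> A \<and>
     (\<forall>U. nbhd_of A U \<longrightarrow> (\<exists>V. nbhd_of A V \<and> (\<forall>n. (f ^^ n) ` V \<subseteq> U))) \<and>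
     (\<exists>U\<^sub>0. nbhd_of A U\<^sub>0 \<and>
        (\<forall>U. nbhd_of A U \<and> U \<subseteq> U\<^sub>0 \<longrightarrow>
           (\<forall>V. nbhd_of A V \<longrightarrow> (\<exists>n\<^sub>0. \<forall>n\<ge>n\<^sub>0. (f ^^ n) ` U \<subseteq> V)))) \<and>
     (\<exists>s\<in>A. omega_limit_set f s = A)"

definition C1_map :: "('a::real_normed_vector \<Rightarrow> 'b::real_normed_vector) \<Rightarrow> bool" where
  "C1_map g \<longleftrightarrow>
     (\<exists>g' :: 'a \<Rightarrow> 'a \<Rightarrow>\<^sub>L 'b.
        (\<forall>x. (g has_derivative blinfun_apply (g' x)) (at x)) \<and> continuous_on UNIV g')"

definition equicontinuous_on ::
    "'a::metric_space set \<Rightarrow> (nat \<Rightarrow> 'a \<Rightarrow> 'b::metric_space) \<Rightarrow> bool" where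
  "equicontinuous_on K g \<longleftrightarrow>
     (\<forall>x\<in>K. \<forall>\<epsilon>>0. \<exists>\<delta>>0. \<forall>t. \<forall>y\<in>K. dist y x < \<delta> \<longrightarrow> dist (g t y) (g t x) < \<epsilon>)"

definition vector_norm :: "('a::real_vector \<Rightarrow> real) \<Rightarrow> bool" where
  "vector_norm N \<longleftrightarrow>
     (\<forall>x. N x = 0 \<longleftrightarrow> x = 0) \<and>
     (\<forall>c x. N (c *\<^sub>R x) = \<bar>c\<bar> * N x) \<and>
     (\<forall>x y. N (x + y) \<le> N x + N y)"

text \<open>
  A matrix of type \<^typ>\<open>real ^ 'n ^ 'm\<close> is the vector of its rows, so this covers both real
  matrices (with a norm on the rows) and column vectors in \<^typ>\<open>real ^ 'm\<close> (with \<^const>\<open>abs\<close>).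
\<close>
definition hajnal_diam :: "('a::minus \<Rightarrow> real) \<Rightarrow> 'a ^ 'm::finite \<Rightarrow> real" where
  "hajnal_diam N L = Max {N (L $ i - L $ j) | i j. True}"

text \<open>The product \<open>B (a + n - 1) ** \<dots> ** B (a + 1) ** B a\<close> of \<open>n\<close> factors.\<close>
primrec left_prod :: "(nat \<Rightarrow> real ^ 'm ^ 'm) \<Rightarrow> nat \<Rightarrow> nat \<Rightarrow> real ^ 'm ^ 'm::finite" where
  "left_prod B a 0 = mat 1"
| "left_prod B a (Suc n) = B (a + n) ** left_prod B a n"

text \<open>
  \<open>\<phi> t i\<close> is the real-valued function giving the \<open>i\<close>-th coordinate of the state at time
  \<open>t + 1\<close> from the state at time \<open>t\<close>.
\<close>
definition coupled_map ::
    "(nat \<Rightarrow> 'm \<Rightarrow> real ^ 'm \<Rightarrow> real) \<Rightarrow> nat \<Rightarrow> real ^ 'm \<Rightarrow> real ^ 'm::finite" where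
  "coupled_map \<phi> t x = (\<chi> i. \<phi> t i x)"

definition solution_from ::
    "(nat \<Rightarrow> 'a \<Rightarrow> 'a) \<Rightarrow> nat \<Rightarrow> (nat \<Rightarrow> 'a) \<Rightarrow> bool" where
  "solution_from F t\<^sub>0 x \<longleftrightarrow> (\<forall>t\<ge>t\<^sub>0. x (Suc t) = F t (x t))"

definition diagonal_jacobian ::
    "(nat \<Rightarrow> 'm \<Rightarrow> real ^ 'm \<Rightarrow> real) \<Rightarrow> nat \<Rightarrow> real \<Rightarrow> real ^ 'm ^ 'm::finite" where
  "diagonal_jacobian \<phi> t s = jacobian (coupled_map \<phi> t) (at (vec s))"

text \<open>
  Extended reals make the supremum and the limit superior meaningful without a boundedness
  assumption. The junk value at \<open>t = 0\<close> does not affect the limit superior.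
\<close>
definition transverse_diam ::
    "(real ^ 'm \<Rightarrow> real) \<Rightarrow> (real \<Rightarrow> real) \<Rightarrow> (nat \<Rightarrow> 'm \<Rightarrow> real ^ 'm \<Rightarrow> real) \<Rightarrow> real
       \<Rightarrow> ereal" where
  "transverse_diam N f \<phi> s\<^sub>0 =
     limsup (\<lambda>t. SUP t\<^sub>0. ereal
       (hajnal_diam N
          (left_prod (\<lambda>k. diagonal_jacobian \<phi> k ((f ^^ (k - t\<^sub>0)) s\<^sub>0)) t\<^sub>0 t :: real ^ 'm ^ 'm::finite)
        powr (1 / real t)))"

definition uniformly_asymptotically_stable_attractor ::
    "(nat \<Rightarrow> 'a::metric_space \<Rightarrow> 'a) \<Rightarrow> 'a set \<Rightarrow> bool" where
  "uniformly_asymptotically_stable_attractor F K \<longleftrightarrow>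
     compact K \<and>
     (\<forall>\<epsilon>>0. \<exists>\<delta>>0. \<forall>t\<^sub>0 x. solution_from F t\<^sub>0 x \<and> infdist (x t\<^sub>0) K < \<delta> \<longrightarrow>
        (\<forall>t\<ge>t\<^sub>0. infdist (x t) K < \<epsilon>)) \<and>
     (\<exists>\<eta>>0. \<forall>\<epsilon>>0. \<exists>T>0. \<forall>t\<^sub>0 x. solution_from F t\<^sub>0 x \<and> infdist (x t\<^sub>0) K < \<eta> \<longrightarrow>
        (\<forall>t\<ge>t\<^sub>0 + T. infdist (x t) K < \<epsilon>))"

definition uniformly_locally_synchronized ::
    "(nat \<Rightarrow> real ^ 'm \<Rightarrow> real ^ 'm::finite) \<Rightarrow> (real \<Rightarrow> real) \<Rightarrow> real set \<Rightarrow> bool" where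
  "uniformly_locally_synchronized F f A \<longleftrightarrow>
     (\<exists>\<eta>>0. \<forall>\<epsilon>>0. \<exists>T>0. \<forall>t\<^sub>0 x s.
        solution_from F t\<^sub>0 x \<and> solution_from (\<lambda>_. f) t\<^sub>0 s \<and> s t\<^sub>0 \<in> A \<and>
        (\<forall>i. \<bar>x t\<^sub>0 $ i - s t\<^sub>0\<bar> < \<eta>) \<longrightarrow>
        (\<forall>t>t\<^sub>0 + T. hajnal_diam abs (x t) \<le> \<epsilon>))"

definition synchronization_manifold :: "(real ^ 'm::finite) set" where
  "synchronization_manifold = {x. \<forall>i j. x $ i = x $ j}"

definition cartesian_power :: "real set \<Rightarrow> (real ^ 'm::finite) set" where
  "cartesian_power A = {x. \<forall>i. x $ i \<in> A}"

end

(*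
  Near a point of A, the n-step flow differs from its linearization along the diagonal by a small
  Lipschitz error, uniformly in the starting time. Since the flow maps the diagonal to itself, the
  Hajnal diameter of the state after n steps is controlled by the row differences of the product
  of Jacobians, so the spectral condition gives an n with a contraction by 1/2. Compactness of A
  makes this uniform on a neighbourhood of the attractor, where diameters therefore decay
  exponentially. A state of small diameter follows the orbit under f of any of its components over
  a fixed time, and the asymptotic stability of A brings that orbit back towards A before the
  next round.
*)
theory Submission
  imports Defs
begin

section \<open>Vectors near the diagonal\<close>

text \<open>Two facts depend on each other: the diameter decays only while the orbit stays near the
  attractor, and the orbit stays near it only while the diameter is small. A bootstrap in rounds of
  fixed length closes this loop. The position relative to \<open>A\<close> is read off a single
  component, and the bound on the diameter does not deteriorate from round to round. The number of
  steps after which the diameter is halved depends on the point, and those steps end near another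
  point with its own number. So contractions of different lengths are chained, with only a common
  upper bound \<open>M\<close> on the lengths; the constant \<open>C\<close> covers the times inside
  the last, incomplete one. Since the products of Jacobians have arbitrarily small Hajnal diameter
  for suitable lengths, the factor 1/2 leaves room for the change of norm and for the linearization
  error.\<close>

lemma hajnal_diam_ge: "N (L $ i - L $ j) \<le> hajnal_diam N (L :: 'a::minus ^ 'm::finite)"
proof -
  have "{N (L $ i - L $ j) | i j. True} = (\<lambda>(i, j). N (L $ i - L $ j)) ` UNIV"
    by auto
  then have "finite {N (L $ i - L $ j) | i j. True}"
    by simp
  then show ?thesis
    unfolding hajnal_diam_def by (rule Max_ge) blast
qed

lemma hajnal_diam_le:
  assumes "\<And>i j. N (L $ i - L $ j) \<le> c"
  shows "hajnal_diam N (L :: 'a::minus ^ 'm::finite) \<le> c"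
proof -
  have "{N (L $ i - L $ j) | i j. True} = (\<lambda>(i, j). N (L $ i - L $ j)) ` UNIV"
    by auto
  then have "finite {N (L $ i - L $ j) | i j. True}"
    by simp
  then show ?thesis
    unfolding hajnal_diam_def by (rule Max.boundedI) (use assms in auto)
qed

lemma hajnal_diam_abs_nonneg: "0 \<le> hajnal_diam abs (x :: real ^ 'm::finite)"
  using hajnal_diam_ge[of abs x undefined undefined] by simp

text \<open>The factor \<open>CARD('m)\<close> comes from bounding the Euclidean norm by the l1
  norm. Most divisions by \<open>CARD('m)\<close> below compensate for it.\<close>

lemma norm_diff_vec_le:
  fixes x :: "real ^ 'm::finite" and c :: real
  assumes "\<And>i. \<bar>x $ i - s\<bar> \<le> c"
  shows "norm (x - vec s) \<le> CARD('m) * c"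
proof -
  have "norm (x - vec s) \<le> (\<Sum>i\<in>UNIV. \<bar>(x - vec s) $ i\<bar>)"
    by (rule norm_le_l1_cart)
  also have "\<dots> \<le> (\<Sum>i\<in>(UNIV :: 'm set). c)"
    by (intro sum_mono) (use assms in simp)
  finally show ?thesis by simp
qed

text \<open>With \<open>hajnal_diam_le_dist_vec\<close> this makes the diameter comparable to the
  distance from the diagonal, so estimates in norm and in diameter can be exchanged at the cost of a
  constant.\<close>

lemma dist_diag_le_hajnal_diam:
  fixes x :: "real ^ 'm::finite"
  shows "dist x (vec (x $ i)) \<le> CARD('m) * hajnal_diam abs x"
  unfolding dist_norm by (rule norm_diff_vec_le) (rule hajnal_diam_ge)

lemma dist_vec_le: "dist (vec s) (vec s' :: real ^ 'm::finite) \<le> CARD('m) * dist s s'"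
  unfolding dist_norm by (rule norm_diff_vec_le) simp

lemma dist_component_vec: "dist (x $ i) s \<le> dist x (vec s :: real ^ 'm::finite)"
  using dist_vec_nth_le[of x i "vec s"] by simp

lemma hajnal_diam_le_dist_vec:
  fixes x :: "real ^ 'm::finite"
  shows "hajnal_diam abs x \<le> 2 * dist x (vec s)"
proof (rule hajnal_diam_le)
  fix i j
  have "\<bar>x $ i - s\<bar> \<le> dist x (vec s)" "\<bar>x $ j - s\<bar> \<le> dist x (vec s)"
    using dist_component_vec[of x i s] dist_component_vec[of x j s] by (auto simp: dist_real_def)
  then show "\<bar>x $ i - x $ j\<bar> \<le> 2 * dist x (vec s)" by linarith
qed

section \<open>Distance to the diagonal copy of \<open>A\<close>\<close>

lemma infdist_less_iff:
  assumes "A \<noteq> {}"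
  shows "infdist x A < e \<longleftrightarrow> (\<exists>a\<in>A. dist x a < e)"
  \<comment> \<open>By convention \<open>infdist\<close> to the empty set is 0, hence the
    assumption.\<close>
  using assms by (simp add: infdist_notempty cINF_less_iff)

lemma infdist_component_le:
  fixes x :: "real ^ 'm::finite" and e :: real
  assumes "infdist x (vec ` A) < e" "A \<noteq> {}"
  shows "infdist (x $ i) A < e"
proof -
  obtain a where "a \<in> A" "dist x (vec a) < e"
    using assms by (auto simp: infdist_less_iff)
  then have "dist (x $ i) a < e"
    using dist_component_vec[of x i a] by simp
  then show ?thesis
    using \<open>a \<in> A\<close> assms(2) by (auto simp: infdist_less_iff)
qed

lemma hajnal_diam_less_infdist:
  fixes x :: "real ^ 'm::finite"
  assumes "infdist x (vec ` A) < e" "A \<noteq> {}"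
  shows "hajnal_diam abs x < 2 * e"
proof -
  obtain a where "a \<in> A" "dist x (vec a) < e"
    using assms by (auto simp: infdist_less_iff)
  then show ?thesis
    using hajnal_diam_le_dist_vec[of x a] by simp
qed

lemma infdist_vec_less:
  fixes s e :: real
  assumes "infdist s A < e" "A \<noteq> {}"
  shows "infdist (vec s :: real ^ 'm::finite) (vec ` A) < CARD('m) * e"
proof -
  obtain a where a: "a \<in> A" "dist s a < e"
    using assms by (auto simp: infdist_less_iff)
  have "dist (vec s) (vec a :: real ^ 'm) \<le> CARD('m) * dist s a"
    by (rule dist_vec_le)
  also have "\<dots> < CARD('m) * e"
    using a by simp
  finally show ?thesis
    using a assms(2) by (auto simp: infdist_less_iff)
qed

lemma cartesian_power_Int_synchronization_manifold:
  "cartesian_power A \<inter> synchronization_manifold = (vec ` A :: (real ^ 'm::finite) set)"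
proof (intro set_eqI iffI)
  fix x :: "real ^ 'm"
  assume "x \<in> cartesian_power A \<inter> synchronization_manifold"
  \<comment> \<open>Index types are nonempty, so \<open>undefined\<close> serves as an arbitrary
    component.\<close>
  then have "x $ undefined \<in> A" "x = vec (x $ undefined)"
    by (auto simp: cartesian_power_def synchronization_manifold_def vec_eq_iff)
  then show "x \<in> vec ` A" by (metis imageI)
qed (auto simp: cartesian_power_def synchronization_manifold_def)

lemma compact_vec_image: "compact A \<Longrightarrow> compact (vec ` A :: (real ^ 'm::finite) set)"
  unfolding vec_def by (intro compact_continuous_image continuous_on_vec_lambda continuous_on_id)

text \<open>One half of the equivalence of norms in finite dimension; it turns bounds on
  \<open>N\<close> of row differences into Euclidean ones. The constant is the reciprocal of the
  minimum of \<open>N\<close> on the Euclidean unit sphere.\<close>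

lemma vector_norm_bound:
  fixes N :: "real ^ 'm::finite \<Rightarrow> real"
  assumes "vector_norm N"
  obtains c where "c > 0" "\<And>v. norm v \<le> c * N v"
proof -
  have zero: "N x = 0 \<longleftrightarrow> x = 0" and scale: "N (r *\<^sub>R x) = \<bar>r\<bar> * N x"
    and triangle: "N (x + y) \<le> N x + N y" for x y r
    using assms by (auto simp: vector_norm_def)
  have N_0: "N 0 = 0"
    by (simp add: zero)
  have minus: "N (- x) = N x" for x
    using scale[of "-1" x] by simp
  \<comment> \<open>Nonnegativity is not among the axioms of \<open>vector_norm\<close>; it follows
    from 0 = N (x + (-x)) \<le> 2 N x.\<close>
  have nonneg: "0 \<le> N x" for x
    using triangle[of x "- x"] minus[of x] N_0 by simp
  define B where "B = (\<Sum>i\<in>UNIV. N (axis i 1))"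
  have sum: "N (\<Sum>i\<in>S. h i) \<le> (\<Sum>i\<in>S. N (h i))" if "finite S" for S and h :: "'m \<Rightarrow> real ^ 'm"
    using that
  proof (induction S rule: finite_induct)
    case (insert i S)
    then show ?case
      using triangle[of "h i" "\<Sum>i\<in>S. h i"] by simp
  qed (simp add: N_0)
  have upper: "N x \<le> B * norm x" for x
  proof -
    have "x = (\<Sum>i\<in>UNIV. x $ i *\<^sub>R axis i 1)"
      using basis_expansion[of x] by (simp add: scalar_mult_eq_scaleR)
    then have "N x \<le> (\<Sum>i\<in>UNIV. N (x $ i *\<^sub>R axis i 1))"
      using sum[of UNIV "\<lambda>i. x $ i *\<^sub>R axis i 1"] by simp
    also have "\<dots> \<le> (\<Sum>i\<in>UNIV. norm x * N (axis i 1))"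
      by (intro sum_mono) (simp add: scale nonneg component_le_norm_cart mult_right_mono)
    finally show ?thesis by (simp add: B_def sum_distrib_left mult.commute)
  qed
  \<comment> \<open>The bound \<open>upper\<close> makes \<open>N\<close> Lipschitz for the
    Euclidean metric, hence continuous on the compact sphere.\<close>
  have "\<bar>N x - N y\<bar> \<le> B * dist x y" for x y
    using triangle[of "x - y" y] triangle[of "y - x" x] upper[of "x - y"] upper[of "y - x"]
    by (simp add: dist_norm norm_minus_commute)
  moreover have "0 \<le> B"
    by (simp add: B_def sum_nonneg nonneg)
  ultimately have "B-lipschitz_on UNIV N"
    by (intro lipschitz_onI) (auto simp: dist_real_def)
  then have "continuous_on (sphere 0 1) N"
    using lipschitz_on_continuous_on continuous_on_subset by blast
  moreover have "compact (sphere (0 :: real ^ 'm) 1)" "sphere (0 :: real ^ 'm) 1 \<noteq> {}"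
    by auto
  ultimately obtain u where u: "u \<in> sphere 0 1" "\<And>v. v \<in> sphere 0 1 \<Longrightarrow> N u \<le> N v"
    using continuous_attains_inf by metis
  have "u \<noteq> 0"
    using u(1) by auto
  then have pos: "N u > 0"
    using nonneg[of u] zero[of u] by linarith
  have "norm v \<le> inverse (N u) * N v" for v
  proof (cases "v = 0")
    case True
    then show ?thesis using nonneg pos by simp
  next
    case False
    then have "N u \<le> N (inverse (norm v) *\<^sub>R v)"
      by (intro u(2)) simp
    then show ?thesis
      using False pos by (simp add: scale field_simps)
  qed
  then show ?thesis
    using that[of "inverse (N u)"] pos by simp
qed

section \<open>The flow of a nonautonomous system\<close>

text \<open>The cocycle of the nonautonomous system: with start time and number of steps as
  arguments, uniformity in the start time is a plain quantifier over \<open>t\<close>.\<close>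

primrec flow :: "(nat \<Rightarrow> 'a \<Rightarrow> 'a) \<Rightarrow> nat \<Rightarrow> nat \<Rightarrow> 'a \<Rightarrow> 'a" where
  "flow F t 0 x = x"
| "flow F t (Suc n) x = F (t + n) (flow F t n x)"

lemma flow_add: "flow F t (m + n) x = flow F (t + m) n (flow F t m x)"
  by (induction n) (simp_all add: add.assoc)

lemma solution_from_flow: "solution_from F t x \<Longrightarrow> x (t + n) = flow F t n (x t)"
  by (induction n) (simp_all add: solution_from_def)

lemma flow_diagonal:
  assumes "\<And>t s. F t (vec s) = vec (f s)"
  shows "flow F t n (vec s) = vec ((f ^^ n) s)"
  by (induction n) (simp_all add: assms)

text \<open>Induction on the number of steps with the compact set generalized: the first step brings
  \<open>x\<close> near \<open>vec (f s)\<close>, where \<open>f s\<close> ranges over another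
  compact set, and the remaining steps start at time \<open>t + 1\<close>.\<close>

lemma flow_tracks_diagonal:
  fixes F :: "nat \<Rightarrow> real ^ 'm::finite \<Rightarrow> real ^ 'm"
  assumes diag: "\<And>t s. F t (vec s) = vec (f s)"
    and cont: "continuous_on UNIV f"
    and equi: "\<And>K. compact K \<Longrightarrow> equicontinuous_on K F"
    and "compact C" "\<epsilon> > 0"
  shows "\<exists>\<gamma>>0. \<forall>t. \<forall>s\<in>C. \<forall>x. dist x (vec s) < \<gamma> \<longrightarrow>
           (\<forall>k\<le>n. dist (flow F t k x) (vec ((f ^^ k) s)) < \<epsilon>)"
  using assms(4,5)
proof (induction n arbitrary: C)
  case 0
  then show ?case by auto
next
  case (Suc n)
  have "compact (f ` C)"
    using Suc.prems(1) cont compact_continuous_image continuous_on_subset by blast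
  from Suc.IH[OF this Suc.prems(2)] obtain \<gamma>1 where \<gamma>1: "\<gamma>1 > 0"
    "\<And>t s x k. s \<in> C \<Longrightarrow> dist x (vec (f s)) < \<gamma>1 \<Longrightarrow> k \<le> n \<Longrightarrow>
       dist (flow F t k x) (vec ((f ^^ k) (f s))) < \<epsilon>"
    by (auto simp: image_iff)
  \<comment> \<open>Equicontinuity becomes uniform only on one compact set containing both
    \<open>vec s\<close> and \<open>x\<close>. The closed 1-neighbourhood serves, which is why the
    radius below is capped at 1; the cap at \<open>\<epsilon>\<close> settles
    \<open>k = 0\<close>.\<close>
  define S where "S = {x. infdist x (vec ` C :: (real ^ 'm) set) \<le> 1}"
  show ?case
  proof (cases "C = {}")
    case True
    then show ?thesis by (auto intro: exI[of _ 1])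
  next
    case False
    then have S: "compact S"
      unfolding S_def using Suc.prems(1) by (intro compact_infdist_le compact_vec_image) auto
    have "\<exists>d>0. \<forall>g\<in>range F. \<forall>x'\<in>S. dist x' x < d \<longrightarrow> dist (g x') (g x) < e"
      if "x \<in> S" "0 < e" for x e
      using equi[OF S] that unfolding equicontinuous_on_def by blast
    from compact_uniformly_equicontinuous[OF S this \<gamma>1(1)] obtain d where d: "d > 0"
      "\<And>t x x'. x \<in> S \<Longrightarrow> x' \<in> S \<Longrightarrow> dist x' x < d \<Longrightarrow> dist (F t x') (F t x) < \<gamma>1"
      by (metis rangeI)
    have "dist (flow F t k x) (vec ((f ^^ k) s)) < \<epsilon>"
      if s: "s \<in> C" and x: "dist x (vec s) < min (min d 1) \<epsilon>" and k: "k \<le> Suc n" for t s x k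
    proof (cases k)
      case (Suc k')
      have "infdist x (vec ` C) \<le> dist x (vec s)" "infdist (vec s :: real ^ 'm) (vec ` C) \<le> 0"
        using s by (auto intro: infdist_le)
      then have "x \<in> S" "vec s \<in> S"
        using x by (auto simp: S_def)
      then have "dist (F t x) (vec (f s)) < \<gamma>1"
        using d(2)[of "vec s" x t] x by (simp add: diag)
      then show ?thesis
        using \<gamma>1(2)[of s "F t x" k' "t + 1"] s k Suc flow_add[of F t 1 k' x]
        by (simp add: funpow_swap1)
    qed (use x in simp)
    then show ?thesis
      using d(1) Suc.prems(2) by (intro exI[of _ "min (min d 1) \<epsilon>"]) auto
  qed
qed

section \<open>Stability from contraction transverse to the diagonal\<close>

lemma nbhd_of_infdist:
  assumes "A \<noteq> {}" "e > 0"
  shows "nbhd_of A {s :: real. infdist s A < e}"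
proof -
  have "open {s. infdist s A < e}"
    by (intro open_Collect_less continuous_intros)
  then show ?thesis
    using assms by (auto simp: nbhd_of_def interior_open)
qed

text \<open>For compact \<open>A\<close> the metric neighbourhoods form a base of its
  neighbourhoods, so the topological conditions on the attractor become epsilon-delta
  conditions.\<close>

lemma nbhd_of_contains_infdist:
  assumes "nbhd_of A U" "compact A" "A \<noteq> {}"
  obtains e where "e > 0" "{s :: real. infdist s A < e} \<subseteq> U"
proof -
  obtain e where e: "e > 0" "(\<Union>x\<in>A. ball x e) \<subseteq> interior U"
    using compact_subset_open_imp_ball_epsilon_subset[of A "interior U"] assms
    by (auto simp: nbhd_of_def)
  have "{s. infdist s A < e} \<subseteq> U"
  proof
    fix s assume "s \<in> {s. infdist s A < e}"
    then obtain a where "a \<in> A" "dist s a < e"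
      using assms(3) by (auto simp: infdist_less_iff)
    then have "s \<in> (\<Union>x\<in>A. ball x e)"
      by (auto simp: dist_commute)
    then show "s \<in> U"
      using e(2) interior_subset by blast
  qed
  then show ?thesis
    using that e(1) by blast
qed

text \<open>The interface between the linearization and the dynamics. The contraction length
  \<open>n\<close> may vary with \<open>x\<close> but not with the start time
  \<open>t\<close>.\<close>

locale diagonal_contraction =
  fixes F :: "nat \<Rightarrow> real ^ 'm::finite \<Rightarrow> real ^ 'm" and f :: "real \<Rightarrow> real" and A :: "real set"
    and \<delta>0 C :: real and M :: nat
  assumes attractor: "asymptotically_stable_attractor f A"
    and tracking: "\<And>n S \<epsilon>. compact S \<Longrightarrow> \<epsilon> > 0 \<Longrightarrow>
      \<exists>\<gamma>>0. \<forall>t. \<forall>s\<in>S. \<forall>x. dist x (vec s) < \<gamma> \<longrightarrow>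
        (\<forall>k\<le>n. dist (flow F t k x) (vec ((f ^^ k) s)) < \<epsilon>)"
    and \<delta>0: "\<delta>0 > 0" and C: "C \<ge> 1"
    and contraction: "\<And>x. infdist x (vec ` A) < \<delta>0 \<Longrightarrow>
      \<exists>n. 1 \<le> n \<and> n \<le> M \<and> (\<forall>t. hajnal_diam abs (flow F t n x) \<le> hajnal_diam abs x / 2 \<and>
        (\<forall>k\<le>n. hajnal_diam abs (flow F t k x) \<le> C * hajnal_diam abs x))"
begin

section \<open>The attractor of \<open>f\<close> in metric terms\<close>

lemma compact_A: "compact A" and A_nonempty: "A \<noteq> {}"
  \<comment> \<open>Nonemptiness comes from the point of \<open>A\<close> whose omega-limit set is
    \<open>A\<close>.\<close>
  using attractor by (auto simp: asymptotically_stable_attractor_def)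

lemma orbits_stay:
  assumes "e > 0"
  obtains d where "d > 0" "\<And>s n. infdist s A < d \<Longrightarrow> infdist ((f ^^ n) s) A < e"
proof -
  obtain V where V: "nbhd_of A V" "\<And>n. (f ^^ n) ` V \<subseteq> {s. infdist s A < e}"
    using attractor nbhd_of_infdist[OF A_nonempty assms]
    unfolding asymptotically_stable_attractor_def by meson
  obtain d where "d > 0" "{s. infdist s A < d} \<subseteq> V"
    using nbhd_of_contains_infdist[OF V(1) compact_A A_nonempty] by blast
  then show ?thesis
    using that[of d] V(2) by blast
qed

text \<open>The bound \<open>e \<le> 1\<close> keeps these neighbourhoods inside the compact set on
  which \<open>flow_near_diagonal_orbit\<close> is uniform.\<close>

lemma orbits_converge:
  obtains e where "e > 0" "e \<le> 1"
    "\<And>e' d. 0 < e' \<Longrightarrow> e' \<le> e \<Longrightarrow> d > 0 \<Longrightarrow>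
       \<exists>n0. \<forall>n\<ge>n0. \<forall>s. infdist s A < e' \<longrightarrow> infdist ((f ^^ n) s) A < d"
proof -
  obtain U0 where U0: "nbhd_of A U0" "\<And>U V. nbhd_of A U \<Longrightarrow> U \<subseteq> U0 \<Longrightarrow> nbhd_of A V \<Longrightarrow>
      \<exists>n0. \<forall>n\<ge>n0. (f ^^ n) ` U \<subseteq> V"
    using attractor unfolding asymptotically_stable_attractor_def by meson
  obtain e where e: "e > 0" "{s. infdist s A < e} \<subseteq> U0"
    using nbhd_of_contains_infdist[OF U0(1) compact_A A_nonempty] by blast
  show ?thesis
  proof (rule that[of "min e 1"])
    fix e' d :: real
    assume e': "0 < e'" "e' \<le> min e 1" "d > 0"
    have "{s. infdist s A < e'} \<subseteq> U0"
      using e(2) e'(2) by auto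
    from U0(2)[OF nbhd_of_infdist[OF A_nonempty e'(1)] this nbhd_of_infdist[OF A_nonempty e'(3)]]
    show "\<exists>n0. \<forall>n\<ge>n0. \<forall>s. infdist s A < e' \<longrightarrow> infdist ((f ^^ n) s) A < d"
      by (simp add: image_subset_iff)
  qed (use e in auto)
qed

section \<open>Decay of the diameter while the orbit stays near \<open>A\<close>\<close>

lemma M_pos: "M > 0"
proof -
  obtain a where "a \<in> A" using A_nonempty by blast
  then have "infdist (vec a :: real ^ 'm) (vec ` A) < \<delta>0"
    using \<delta>0 by simp
  from contraction[OF this] show ?thesis by auto
qed

text \<open>Split the \<open>n\<close> steps into successive contractions of length at most
  \<open>M\<close>. At least \<open>n div M\<close> of them are complete and each halves the
  diameter; the incomplete one at the end costs \<open>C\<close>, and only once.\<close>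

lemma diam_decay:
  assumes "\<And>k. k < n \<Longrightarrow> infdist (flow F t k x) (vec ` A) < \<delta>0"
  shows "hajnal_diam abs (flow F t n x) \<le> C * (1 / 2) ^ (n div M) * hajnal_diam abs x"
  using assms
proof (induction n arbitrary: t x rule: less_induct)
  case (less n)
  show ?case
  proof (cases "n = 0")
    case True
    then show ?thesis
      using C mult_right_mono[OF C hajnal_diam_abs_nonneg[of x]] by simp
  next
    case False
    then have "infdist x (vec ` A) < \<delta>0"
      using less.prems[of 0] by simp
    then obtain p where p: "1 \<le> p" "p \<le> M" "hajnal_diam abs (flow F t p x) \<le> hajnal_diam abs x / 2"
        "\<And>k. k \<le> p \<Longrightarrow> hajnal_diam abs (flow F t k x) \<le> C * hajnal_diam abs x"
      using contraction by blast
    show ?thesis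
    proof (cases "n < p")
      case True
      \<comment> \<open>Here \<open>n < p \<le> M\<close>, so the exponent \<open>n div M\<close> is
        0.\<close>
      then show ?thesis using p(2) p(4)[of n] by simp
    next
      case False
      have *: "flow F t (p + k) x = flow F (t + p) k (flow F t p x)" for k
        by (rule flow_add)
      have "n div M \<le> ((n - p) + M) div M"
        by (rule div_le_mono) (use p(2) False in simp)
      also have "\<dots> = Suc ((n - p) div M)"
        using M_pos by simp
      finally have "n div M \<le> Suc ((n - p) div M)" .
      then have half: "(1 / 2 :: real) ^ Suc ((n - p) div M) \<le> (1 / 2) ^ (n div M)"
        by (intro power_decreasing) auto
      have "hajnal_diam abs (flow F t n x) = hajnal_diam abs (flow F (t + p) (n - p) (flow F t p x))"
        using *[of "n - p"] False by simp
      also have "\<dots> \<le> C * (1 / 2) ^ ((n - p) div M) * hajnal_diam abs (flow F t p x)"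
      proof (rule less.IH)
        show "n - p < n" using p(1) False by simp
        show "infdist (flow F (t + p) k (flow F t p x)) (vec ` A) < \<delta>0" if "k < n - p" for k
          using less.prems[of "p + k"] that by (simp add: *)
      qed
      also have "\<dots> \<le> C * (1 / 2) ^ ((n - p) div M) * (hajnal_diam abs x / 2)"
        using C p(3) by (intro mult_left_mono) auto
      also have "\<dots> = C * (1 / 2) ^ Suc ((n - p) div M) * hajnal_diam abs x"
        by simp
      also have "\<dots> \<le> C * (1 / 2) ^ (n div M) * hajnal_diam abs x"
        using C half hajnal_diam_abs_nonneg[of x]
        by (intro mult_right_mono mult_left_mono) auto
      finally show ?thesis .
    qed
  qed
qed

text \<open>The reference orbit starts at a component of \<open>x\<close> itself, not at a point of
  \<open>A\<close>. The error is then governed by the diameter alone, and the component only has to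
  lie in a fixed compact neighbourhood of \<open>A\<close>.\<close>

lemma flow_near_diagonal_orbit:
  assumes "d > 0"
  obtains \<gamma> where "\<gamma> > 0"
    "\<And>t x i k. infdist (x $ i) A < 1 \<Longrightarrow> hajnal_diam abs x < \<gamma> \<Longrightarrow> k \<le> n \<Longrightarrow>
       dist (flow F t k x) (vec ((f ^^ k) (x $ i))) < d"
proof -
  have "compact {s. infdist s A \<le> 1}"
    using compact_A A_nonempty by (intro compact_infdist_le) auto
  from tracking[OF this assms, of n] obtain \<gamma> where \<gamma>: "\<gamma> > 0"
    "\<And>t s x k. infdist s A \<le> 1 \<Longrightarrow> dist x (vec s) < \<gamma> \<Longrightarrow> k \<le> n \<Longrightarrow>
       dist (flow F t k x) (vec ((f ^^ k) s)) < d"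
    by blast
  show ?thesis
  proof (rule that[of "\<gamma> / CARD('m)"])
    fix t k i and x :: "real ^ 'm"
    assume *: "infdist (x $ i) A < 1" "hajnal_diam abs x < \<gamma> / CARD('m)" "k \<le> n"
    have "dist x (vec (x $ i)) \<le> CARD('m) * hajnal_diam abs x"
      by (rule dist_diag_le_hajnal_diam)
    also have "\<dots> < \<gamma>"
      using *(2) by (simp add: field_simps)
    finally show "dist (flow F t k x) (vec ((f ^^ k) (x $ i))) < d"
      using \<gamma>(2) * by simp
  qed (use \<gamma>(1) in simp)
qed

section \<open>Stability and convergence of the flow\<close>

lemma infdist_vec_le_add:
  fixes x :: "real ^ 'm" and e :: real
  assumes "dist x (vec s) < e / 2" "infdist s A < e / (2 * CARD('m))"
  shows "infdist x (vec ` A) < e"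
proof -
  have "infdist x (vec ` A) \<le> infdist (vec s :: real ^ 'm) (vec ` A) + dist x (vec s)"
    by (rule infdist_triangle)
  also have "\<dots> < CARD('m) * (e / (2 * CARD('m))) + e / 2"
    using assms infdist_vec_less[OF assms(2) A_nonempty, where 'm = 'm] by (intro add_strict_mono)
  also have "\<dots> = e" by simp
  finally show ?thesis .
qed

text \<open>
  The trap consists of the states of diameter less than \<open>\<gamma>\<close> with a component within \<open>r\<close>
  of \<open>A\<close>. After \<open>p\<close> steps that component is again within \<open>r\<close>, by the attraction of \<open>f\<close>; the
  diameter never exceeds \<open>C\<close> times its initial value, so it need not shrink in each round.
\<close>
lemma flow_stays:
  assumes "\<epsilon> > 0"
  obtains \<delta> where "\<delta> > 0"
    "\<And>t x k. infdist x (vec ` A) < \<delta> \<Longrightarrow> infdist (flow F t k x) (vec ` A) < \<epsilon>"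
proof -
  \<comment> \<open>Staying below \<open>\<delta>0\<close> as well keeps \<open>contraction\<close>
    applicable, so that \<open>diam_decay\<close> can be used along the orbit.\<close>
  define \<epsilon>' where "\<epsilon>' = min \<epsilon> \<delta>0"
  have \<epsilon>': "\<epsilon>' > 0" "\<epsilon>' \<le> \<epsilon>" "\<epsilon>' \<le> \<delta>0"
    using assms \<delta>0 by (auto simp: \<epsilon>'_def)
  obtain d where d: "d > 0" "\<And>s n. infdist s A < d \<Longrightarrow> infdist ((f ^^ n) s) A < \<epsilon>' / (2 * CARD('m))"
    using orbits_stay[of "\<epsilon>' / (2 * CARD('m))"] \<epsilon>' by auto
  obtain e where e: "e > 0" "e \<le> 1" "\<And>e' d. 0 < e' \<Longrightarrow> e' \<le> e \<Longrightarrow> d > 0 \<Longrightarrow>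
       \<exists>n0. \<forall>n\<ge>n0. \<forall>s. infdist s A < e' \<longrightarrow> infdist ((f ^^ n) s) A < d"
    using orbits_converge by metis
  define r where "r = min d e"
  have r: "0 < r" "r \<le> e" "r \<le> d" "r \<le> 1"
    using d(1) e(1,2) by (auto simp: r_def)
  obtain n0 where n0: "\<And>n s. n \<ge> n0 \<Longrightarrow> infdist s A < r \<Longrightarrow> infdist ((f ^^ n) s) A < r / 2"
    using e(3)[OF r(1,2), of "r / 2"] r(1) by auto
  \<comment> \<open>The successor makes \<open>p\<close> positive, so the times \<open>j * p\<close>
    eventually pass every \<open>k\<close>; at the end \<open>k \<le> k * p\<close> is used.\<close>
  define p where "p = Suc n0"
  obtain \<gamma> where \<gamma>: "\<gamma> > 0"
    "\<And>t x i k. infdist (x $ i) A < 1 \<Longrightarrow> hajnal_diam abs x < \<gamma> \<Longrightarrow> k \<le> p \<Longrightarrow>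
       dist (flow F t k x) (vec ((f ^^ k) (x $ i))) < min (\<epsilon>' / 2) (r / 2)"
    using flow_near_diagonal_orbit[of "min (\<epsilon>' / 2) (r / 2)" p] \<epsilon>'(1) r(1) by auto
  have round: "infdist (flow F t k x) (vec ` A) < \<epsilon>'" "infdist (flow F t p x $ i) A < r"
    if "infdist (x $ i) A < r" "hajnal_diam abs x < \<gamma>" "k \<le> p" for t x i k
  proof -
    have near: "dist (flow F t k x) (vec ((f ^^ k) (x $ i))) < min (\<epsilon>' / 2) (r / 2)" if "k \<le> p" for k
      using \<gamma>(2)[OF _ \<open>hajnal_diam abs x < \<gamma>\<close> that] \<open>infdist (x $ i) A < r\<close> r(4) by simp
    show "infdist (flow F t k x) (vec ` A) < \<epsilon>'"
      using near[OF \<open>k \<le> p\<close>] d(2) that(1) r(3) by (intro infdist_vec_le_add) auto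
    have "infdist (flow F t p x $ i) A
        \<le> infdist ((f ^^ p) (x $ i)) A + dist (flow F t p x $ i) ((f ^^ p) (x $ i))"
      by (rule infdist_triangle)
    also have "\<dots> < r / 2 + r / 2"
    proof (rule add_strict_mono)
      show "infdist ((f ^^ p) (x $ i)) A < r / 2"
        using n0[of p] that(1) by (simp add: p_def)
      show "dist (flow F t p x $ i) ((f ^^ p) (x $ i)) < r / 2"
        using near[of p] dist_component_vec[of "flow F t p x" i "(f ^^ p) (x $ i)"] by simp
    qed
    finally show "infdist (flow F t p x $ i) A < r" by simp
  qed
  \<comment> \<open>A state within \<open>\<delta>\<close> has diameter below
    \<open>2 * \<delta>\<close>; the division by \<open>C\<close> pays for the growth allowed by
    \<open>diam_decay\<close>.\<close>
  define \<delta> where "\<delta> = min r (\<gamma> / (2 * C))"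
  have "infdist (flow F t k x) (vec ` A) < \<epsilon>" if x: "infdist x (vec ` A) < \<delta>" for t x k
  proof -
    define i :: 'm where "i = undefined"
    have "hajnal_diam abs x < 2 * \<delta>"
      by (rule hajnal_diam_less_infdist[OF x A_nonempty])
    also have "\<dots> \<le> \<gamma> / C"
      using C by (simp add: \<delta>_def min_def field_simps)
    finally have start: "C * hajnal_diam abs x < \<gamma>"
      using C by (simp add: field_simps)
    \<comment> \<open>Closeness to the attractor before time \<open>j * p\<close> bounds the
      diameter at \<open>j * p\<close>, and this bound carries the orbit through the next
      \<open>p\<close> steps.\<close>
    have "infdist (flow F t (j * p) x $ i) A < r \<and> (\<forall>k\<le>j * p. infdist (flow F t k x) (vec ` A) < \<epsilon>')" for j
    proof (induction j)
      case 0
      have "infdist (x $ i) A < r"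
        using infdist_component_le[OF x A_nonempty] by (simp add: \<delta>_def)
      moreover have "hajnal_diam abs x < \<gamma>"
        using start C mult_right_mono[OF C hajnal_diam_abs_nonneg[of x]] by simp
      ultimately show ?case
        using round(1)[of x i 0] by simp
    next
      case (Suc j)
      define y where "y = flow F t (j * p) x"
      have split: "flow F t (j * p + k) x = flow F (t + j * p) k y" for k
        by (simp add: y_def flow_add)
      have "hajnal_diam abs y \<le> C * (1 / 2) ^ (j * p div M) * hajnal_diam abs x"
        unfolding y_def by (rule diam_decay) (meson Suc.IH \<epsilon>'(3) less_imp_le less_le_trans)
      also have "\<dots> \<le> C * hajnal_diam abs x"
        using C hajnal_diam_abs_nonneg[of x] by (intro mult_right_mono) (auto simp: mult_le_cancel_left1 power_le_one)
      finally have y: "hajnal_diam abs y < \<gamma>" "infdist (y $ i) A < r"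
        using start Suc.IH by (auto simp: y_def)
      have "infdist (flow F t k x) (vec ` A) < \<epsilon>'" if "k \<le> Suc j * p" for k
      proof (cases "k \<le> j * p")
        case False
        then show ?thesis
          using round(1)[OF y(2,1), of "k - j * p" "t + j * p"] split[of "k - j * p"] that by simp
      qed (use Suc.IH in simp)
      moreover have "infdist (flow F t (Suc j * p) x $ i) A < r"
        using round(2)[OF y(2,1), of p "t + j * p"] split[of p] by (simp add: add.commute)
      ultimately show ?case by blast
    qed
    from this[of k] have "infdist (flow F t k x) (vec ` A) < \<epsilon>'"
      by (simp add: p_def)
    then show ?thesis using \<epsilon>'(2) by simp
  qed
  moreover have "\<delta> > 0"
    using r(1) \<gamma>(1) C by (simp add: \<delta>_def)
  ultimately show ?thesis
    using that by blast
qed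

text \<open>Reduction to stability: it suffices to enter, at one time, a neighbourhood from which
  \<open>flow_stays\<close> never lets the orbit leave the target. First \<open>q * M\<close> steps
  shrink the diameter, then \<open>p\<close> steps follow an orbit of \<open>f\<close> towards
  \<open>A\<close>.\<close>

lemma flow_converges:
  obtains \<eta> where "\<eta> > 0"
    "\<And>\<epsilon>. \<epsilon> > 0 \<Longrightarrow> \<exists>T. \<forall>t x k. infdist x (vec ` A) < \<eta> \<and> T \<le> k \<longrightarrow>
       infdist (flow F t k x) (vec ` A) < \<epsilon>"
proof -
  obtain e where e: "e > 0" "e \<le> 1" "\<And>e' d. 0 < e' \<Longrightarrow> e' \<le> e \<Longrightarrow> d > 0 \<Longrightarrow>
       \<exists>n0. \<forall>n\<ge>n0. \<forall>s. infdist s A < e' \<longrightarrow> infdist ((f ^^ n) s) A < d"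
    using orbits_converge by metis
  obtain \<eta> where \<eta>: "\<eta> > 0"
    "\<And>t x k. infdist x (vec ` A) < \<eta> \<Longrightarrow> infdist (flow F t k x) (vec ` A) < min e \<delta>0"
    using flow_stays[of "min e \<delta>0"] e(1) \<delta>0 by auto
  have "\<exists>T. \<forall>t x k. infdist x (vec ` A) < \<eta> \<and> T \<le> k \<longrightarrow> infdist (flow F t k x) (vec ` A) < \<epsilon>"
    if pos: "\<epsilon> > 0" for \<epsilon>
  proof -
    obtain \<delta> where \<delta>: "\<delta> > 0"
      "\<And>t x k. infdist x (vec ` A) < \<delta> \<Longrightarrow> infdist (flow F t k x) (vec ` A) < \<epsilon>"
      using flow_stays[OF pos] by blast
    obtain p where p: "\<And>s. infdist s A < e \<Longrightarrow> infdist ((f ^^ p) s) A < \<delta> / (2 * CARD('m))"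
      using e(3)[of e "\<delta> / (2 * CARD('m))"] e(1) \<delta>(1) by auto
    obtain \<gamma> where \<gamma>: "\<gamma> > 0"
      "\<And>t x i k. infdist (x $ i) A < 1 \<Longrightarrow> hajnal_diam abs x < \<gamma> \<Longrightarrow> k \<le> p \<Longrightarrow>
         dist (flow F t k x) (vec ((f ^^ k) (x $ i))) < \<delta> / 2"
      using flow_near_diagonal_orbit[of "\<delta> / 2" p] \<delta>(1) by auto
    \<comment> \<open>The initial diameter is below \<open>2 * e\<close> since \<open>x\<close> is
      within \<open>e\<close> of the attractor, so after \<open>q * M\<close> steps the diameter is
      below \<open>\<gamma>\<close>.\<close>
    obtain q where q: "(1 / 2) ^ q < \<gamma> / (C * (2 * e))"
      using real_arch_pow_inv[of "\<gamma> / (C * (2 * e))" "1 / 2"] \<gamma>(1) C e(1) by auto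
    have "infdist (flow F t k x) (vec ` A) < \<epsilon>"
      if x: "infdist x (vec ` A) < \<eta>" and k: "q * M + p \<le> k" for t x k
    proof -
      define i :: 'm where "i = undefined"
      define y where "y = flow F t (q * M) x"
      have y: "infdist (y $ i) A < e"
        using infdist_component_le[OF _ A_nonempty, of y "min e \<delta>0"] \<eta>(2)[OF x] by (simp add: y_def)
      have "hajnal_diam abs x < 2 * e"
        using hajnal_diam_less_infdist[OF _ A_nonempty, of x "min e \<delta>0"] \<eta>(2)[OF x, of _ 0] by simp
      have "hajnal_diam abs y \<le> C * (1 / 2) ^ (q * M div M) * hajnal_diam abs x"
        unfolding y_def by (rule diam_decay) (use \<eta>(2)[OF x] in simp)
      also have "\<dots> = (1 / 2) ^ q * (C * hajnal_diam abs x)"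
        using M_pos by simp
      also have "\<dots> \<le> (1 / 2) ^ q * (C * (2 * e))"
        using \<open>hajnal_diam abs x < 2 * e\<close> C by (intro mult_left_mono) auto
      also have "\<dots> < \<gamma>"
        using q C e(1) by (simp add: field_simps)
      finally have "dist (flow F (t + q * M) p y) (vec ((f ^^ p) (y $ i))) < \<delta> / 2"
        using \<gamma>(2) y e(2) by simp
      then have "infdist (flow F (t + q * M) p y) (vec ` A) < \<delta>"
        using p[OF y] by (rule infdist_vec_le_add)
      from \<delta>(2)[OF this, of "t + (q * M + p)" "k - (q * M + p)"] show ?thesis
        using flow_add[of F t "q * M + p" "k - (q * M + p)" x] flow_add[of F t "q * M" p x] k
        by (simp add: y_def)
    qed
    then show ?thesis by blast
  qed
  then show ?thesis
    using that \<eta>(1) by blast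
qed

theorem synchronization:
  "uniformly_asymptotically_stable_attractor F (vec ` A) \<and> uniformly_locally_synchronized F f A"
proof
  obtain \<eta> where \<eta>: "\<eta> > 0"
    "\<And>\<epsilon>. \<epsilon> > 0 \<Longrightarrow> \<exists>T. \<forall>t x k. infdist x (vec ` A) < \<eta> \<and> T \<le> k \<longrightarrow>
       infdist (flow F t k x) (vec ` A) < \<epsilon>"
    using flow_converges by metis
  have attract: "\<exists>T>0. \<forall>t0 x. solution_from F t0 x \<and> infdist (x t0) (vec ` A) < \<eta> \<longrightarrow>
      (\<forall>t\<ge>t0 + T. infdist (x t) (vec ` A) < \<epsilon>)" if pos: "\<epsilon> > 0" for \<epsilon>
  proof -
    obtain T where T: "\<And>t x k. infdist x (vec ` A) < \<eta> \<Longrightarrow> T \<le> k \<Longrightarrow>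
        infdist (flow F t k x) (vec ` A) < \<epsilon>"
      using \<eta>(2)[OF pos] by blast
    \<comment> \<open>\<open>Suc T\<close> replaces \<open>T\<close> because the waiting time must
      be positive.\<close>
    have "infdist (x t) (vec ` A) < \<epsilon>"
      if "solution_from F t0 x" "infdist (x t0) (vec ` A) < \<eta>" "t \<ge> t0 + Suc T" for t0 x t
      using T[OF that(2), of "t - t0" t0] solution_from_flow[OF that(1), of "t - t0"] that(3) by simp
    then show ?thesis by blast
  qed
  have "\<exists>\<delta>>0. \<forall>t0 x. solution_from F t0 x \<and> infdist (x t0) (vec ` A) < \<delta> \<longrightarrow>
      (\<forall>t\<ge>t0. infdist (x t) (vec ` A) < \<epsilon>)" if pos: "\<epsilon> > 0" for \<epsilon>
  proof -
    obtain \<delta> where \<delta>: "\<delta> > 0"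
      "\<And>t x k. infdist x (vec ` A) < \<delta> \<Longrightarrow> infdist (flow F t k x) (vec ` A) < \<epsilon>"
      using flow_stays[OF pos] by blast
    have "infdist (x t) (vec ` A) < \<epsilon>"
      if "solution_from F t0 x" "infdist (x t0) (vec ` A) < \<delta>" "t \<ge> t0" for t0 x t
      using \<delta>(2)[OF that(2), of t0 "t - t0"] solution_from_flow[OF that(1), of "t - t0"] that(3) by simp
    then show ?thesis using \<delta>(1) by blast
  qed
  then show "uniformly_asymptotically_stable_attractor F (vec ` A)"
    unfolding uniformly_asymptotically_stable_attractor_def
    using attract \<eta>(1) compact_vec_image[OF compact_A] by blast
  show "uniformly_locally_synchronized F f A"
    unfolding uniformly_locally_synchronized_def
  \<comment> \<open>This componentwise radius gives Euclidean distance at most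
    \<open>\<eta> / 2\<close> from \<open>vec (s t0)\<close>, a point of the attractor.\<close>
  proof (intro exI[of _ "\<eta> / (2 * CARD('m))"] conjI allI impI)
    fix \<epsilon> :: real
    assume "\<epsilon> > 0"
    then obtain T where T: "T > 0"
      "\<And>t0 x t. solution_from F t0 x \<Longrightarrow> infdist (x t0) (vec ` A) < \<eta> \<Longrightarrow> t \<ge> t0 + T \<Longrightarrow>
         infdist (x t) (vec ` A) < \<epsilon> / 2"
      using attract[of "\<epsilon> / 2"] by (meson half_gt_zero)
    have "hajnal_diam abs (x t) \<le> \<epsilon>"
      if "solution_from F t0 x" "s t0 \<in> A" "\<And>i. \<bar>x t0 $ i - s t0\<bar> < \<eta> / (2 * CARD('m))" "t > t0 + T"
      for t0 x s t
    proof -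
      have "norm (x t0 - vec (s t0)) \<le> CARD('m) * (\<eta> / (2 * CARD('m)))"
        using that(3) by (intro norm_diff_vec_le less_imp_le)
      also have "\<dots> < \<eta>"
        using \<eta>(1) by simp
      finally have "infdist (x t0) (vec ` A) < \<eta>"
        using infdist_le[of "vec (s t0)" "vec ` A" "x t0"] that(2) by (simp add: dist_norm)
      then show ?thesis
        using T(2)[of t0 x t] that hajnal_diam_less_infdist[OF _ A_nonempty, of "x t" "\<epsilon> / 2"] by simp
    qed
    then show "\<exists>T>0. \<forall>t0 x s. solution_from F t0 x \<and> solution_from (\<lambda>_. f) t0 s \<and> s t0 \<in> A \<and>
        (\<forall>i. \<bar>x t0 $ i - s t0\<bar> < \<eta> / (2 * CARD('m))) \<longrightarrow> (\<forall>t>t0 + T. hajnal_diam abs (x t) \<le> \<epsilon>)"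
      using T(1) by blast
  qed (use \<eta>(1) in simp)
qed

end

section \<open>Strict differentiability uniformly in time\<close>

text \<open>The remainder compares two arbitrary points near \<open>p\<close>. This form is
  essential: \<open>x\<close> will be compared with a diagonal point made from its own component, at
  a distance of the order of the diameter, whereas a derivative at \<open>p\<close> alone leaves an
  error relative to the possibly much larger distance from \<open>p\<close>.\<close>

definition uniformly_strictly_differentiable ::
    "(nat \<Rightarrow> 'a::real_normed_vector \<Rightarrow> 'b::real_normed_vector) \<Rightarrow> (nat \<Rightarrow> 'a \<Rightarrow> 'b) \<Rightarrow> 'a \<Rightarrow> bool" where
  "uniformly_strictly_differentiable G L p \<longleftrightarrow>
     (\<forall>t. linear (L t)) \<and> (\<exists>B. \<forall>t v. norm (L t v) \<le> B * norm v) \<and>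
     (\<forall>e>0. \<exists>d>0. \<forall>t. \<forall>x\<in>ball p d. \<forall>y\<in>ball p d.
        norm (G t x - G t y - L t (x - y)) \<le> e * norm (x - y))"

lemma uniformly_strictly_differentiableD:
  assumes "uniformly_strictly_differentiable G L p" "e > 0"
  obtains d where "d > 0"
    "\<And>t x y. x \<in> ball p d \<Longrightarrow> y \<in> ball p d \<Longrightarrow> norm (G t x - G t y - L t (x - y)) \<le> e * norm (x - y)"
  using assms unfolding uniformly_strictly_differentiable_def by metis

lemma uniformly_strictly_differentiable_bound:
  assumes "uniformly_strictly_differentiable G L p"
  obtains B where "B > 0" "\<And>t v. norm (L t v) \<le> B * norm v"
proof -
  obtain B where B: "\<And>t v. norm (L t v) \<le> B * norm v"
    using assms unfolding uniformly_strictly_differentiable_def by blast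
  have "norm (L t v) \<le> max B 1 * norm v" for t v
    using B[of t v] mult_right_mono[of B "max B 1" "norm v"] by simp
  then show ?thesis
    using that[of "max B 1"] by simp
qed

lemma uniformly_strictly_differentiable_lipschitz:
  assumes "uniformly_strictly_differentiable G L p"
  obtains B d where "B > 0" "d > 0"
    "\<And>t x y. x \<in> ball p d \<Longrightarrow> y \<in> ball p d \<Longrightarrow> norm (G t x - G t y) \<le> B * norm (x - y)"
proof -
  obtain B where B: "B > 0" "\<And>t v. norm (L t v) \<le> B * norm v"
    using uniformly_strictly_differentiable_bound[OF assms] by blast
  obtain d where d: "d > 0" "\<And>t x y. x \<in> ball p d \<Longrightarrow> y \<in> ball p d \<Longrightarrow>
      norm (G t x - G t y - L t (x - y)) \<le> 1 * norm (x - y)"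
    using uniformly_strictly_differentiableD[OF assms, of 1] by auto
  have "norm (G t x - G t y) \<le> (B + 1) * norm (x - y)" if "x \<in> ball p d" "y \<in> ball p d" for t x y
    using d(2)[OF that, of t] B(2)[of t "x - y"]
      norm_triangle_sub[of "G t x - G t y" "L t (x - y)"] by (simp add: algebra_simps)
  then show ?thesis
    using that[of "B + 1" d] B(1) d(1) by simp
qed

text \<open>The chain rule, uniformly in time. The middle point \<open>q\<close> must not depend on
  \<open>t\<close>; for the flow this holds because on the diagonal it is the autonomous iteration
  of \<open>f\<close>.\<close>

lemma uniformly_strictly_differentiable_compose:
  assumes G: "uniformly_strictly_differentiable G L p" and q: "\<And>t. G t p = q"
    and H: "uniformly_strictly_differentiable H M q"
  shows "uniformly_strictly_differentiable (\<lambda>t x. H t (G t x)) (\<lambda>t v. M t (L t v)) p"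
proof -
  obtain B where B: "B > 0" "\<And>t v. norm (L t v) \<le> B * norm v"
    using uniformly_strictly_differentiable_bound[OF G] by blast
  obtain B' where B': "B' > 0" "\<And>t v. norm (M t v) \<le> B' * norm v"
    using uniformly_strictly_differentiable_bound[OF H] by blast
  obtain c d0 where c: "c > 0" "d0 > 0"
    "\<And>t x y. x \<in> ball p d0 \<Longrightarrow> y \<in> ball p d0 \<Longrightarrow> norm (G t x - G t y) \<le> c * norm (x - y)"
    using uniformly_strictly_differentiable_lipschitz[OF G] by blast
  have linear: "linear (L t)" "linear (M t)" for t
    using G H by (auto simp: uniformly_strictly_differentiable_def)
  have "\<exists>d>0. \<forall>t. \<forall>x\<in>ball p d. \<forall>y\<in>ball p d.
      norm (H t (G t x) - H t (G t y) - M t (L t (x - y))) \<le> e * norm (x - y)" if pos: "e > 0" for e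
  proof -
    obtain d1 where d1: "d1 > 0" "\<And>t x y. x \<in> ball p d1 \<Longrightarrow> y \<in> ball p d1 \<Longrightarrow>
        norm (G t x - G t y - L t (x - y)) \<le> e / (2 * B') * norm (x - y)"
      using uniformly_strictly_differentiableD[OF G, of "e / (2 * B')"] pos B'(1) by auto
    obtain d2 where d2: "d2 > 0" "\<And>t x y. x \<in> ball q d2 \<Longrightarrow> y \<in> ball q d2 \<Longrightarrow>
        norm (H t x - H t y - M t (x - y)) \<le> e / (2 * c) * norm (x - y)"
      using uniformly_strictly_differentiableD[OF H, of "e / (2 * c)"] pos c(1) by auto
    define d where "d = min (min d0 d1) (d2 / c)"
    have "d > 0" using c d1 d2 by (simp add: d_def)
    have image: "G t x \<in> ball q d2" if "x \<in> ball p d" for t x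
    proof -
      have "norm (G t p - G t x) \<le> c * norm (p - x)"
        using that c(2) by (intro c(3)) (auto simp: d_def)
      also have "\<dots> < d2"
        using that c(1) by (simp add: d_def dist_norm field_simps)
      finally show ?thesis by (simp add: dist_norm q)
    qed
    have "norm (H t (G t x) - H t (G t y) - M t (L t (x - y))) \<le> e * norm (x - y)"
      if x: "x \<in> ball p d" and y: "y \<in> ball p d" for t x y
    proof -
      \<comment> \<open>Each summand receives half of \<open>e\<close>: the remainder of
        \<open>H\<close> after the Lipschitz bound \<open>c\<close> for \<open>G\<close>, and
        \<open>M t\<close> applied to the remainder of \<open>G\<close> after the bound
        \<open>B'\<close>.\<close>
      have "H t (G t x) - H t (G t y) - M t (L t (x - y)) =
          (H t (G t x) - H t (G t y) - M t (G t x - G t y)) + M t (G t x - G t y - L t (x - y))"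
        by (simp add: linear_diff[OF linear(2)])
      then have "norm (H t (G t x) - H t (G t y) - M t (L t (x - y))) \<le>
          norm (H t (G t x) - H t (G t y) - M t (G t x - G t y)) + norm (M t (G t x - G t y - L t (x - y)))"
        using norm_triangle_ineq by metis
      also have "\<dots> \<le> e / (2 * c) * norm (G t x - G t y) + B' * norm (G t x - G t y - L t (x - y))"
        by (intro add_mono d2(2) image x y B'(2))
      also have "\<dots> \<le> e / (2 * c) * (c * norm (x - y)) + B' * (e / (2 * B') * norm (x - y))"
        using x y c(1) B'(1) pos by (intro add_mono mult_left_mono c(3) d1(2)) (auto simp: d_def)
      also have "\<dots> = e * norm (x - y)"
        using c(1) B'(1) by simp
      finally show ?thesis .
    qed
    then show ?thesis using \<open>d > 0\<close> by blast
  qed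
  moreover have "norm (M t (L t v)) \<le> (B' * B) * norm v" for t v
    using order_trans[OF B'(2) mult_left_mono[OF B(2), of B']] B'(1) by (simp add: mult.assoc)
  moreover have "linear (\<lambda>v. M t (L t v))" for t
    using linear_compose[OF linear] by (simp add: o_def)
  ultimately show ?thesis
    unfolding uniformly_strictly_differentiable_def by blast
qed

text \<open>
  Equicontinuity of the maps themselves is what bounds the derivatives uniformly in time:
  on a fixed small ball the linear part differs little from an increment of the map.
\<close>
lemma uniformly_strictly_differentiable_equicontinuous:
  fixes F :: "nat \<Rightarrow> real ^ 'n::finite \<Rightarrow> real ^ 'm::finite"
  assumes deriv: "\<And>t x. (F t has_derivative (*v) (J t x)) (at x)"
    and F: "equicontinuous_on (cball p 1) F" and J: "equicontinuous_on (cball p 1) J"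
  shows "uniformly_strictly_differentiable F (\<lambda>t. (*v) (J t p)) p"
proof -
  have strict: "\<exists>d>0. \<forall>t. \<forall>x\<in>ball p d. \<forall>y\<in>ball p d.
      norm (F t x - F t y - J t p *v (x - y)) \<le> e * norm (x - y)" if pos: "e > 0" for e
  proof -
    \<comment> \<open>Entries bounded by \<open>e'\<close> give an operator norm of at most
      \<open>CARD('m) * CARD('n) * e'\<close>, that is, \<open>e\<close>.\<close>
    define e' where "e' = e / (CARD('m) * CARD('n))"
    have "e' > 0" using pos by (simp add: e'_def)
    moreover have "p \<in> cball p 1" by simp
    ultimately obtain d where d: "d > 0"
      "\<And>t z. z \<in> cball p 1 \<Longrightarrow> dist z p < d \<Longrightarrow> dist (J t z) (J t p) < e'"
      using J unfolding equicontinuous_on_def by meson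
    define r where "r = min d 1"
    have "norm (F t x - F t y - J t p *v (x - y)) \<le> e * norm (x - y)"
      if x: "x \<in> ball p r" and y: "y \<in> ball p r" for t x y
    proof -
      have "norm (F t x - F t y - J t p *v (x - y)) \<le> norm (x - y) * e"
      proof (rule differentiable_bound_linearization[where S = "ball p r" and f' = "\<lambda>z. (*v) (J t z)"])
        show "y + u *\<^sub>R (x - y) \<in> ball p r" if "u \<in> {0..1}" for u
          using convexD_alt[OF convex_ball y x, of u] that by (simp add: algebra_simps)
        show "(F t has_derivative (*v) (J t z)) (at z within ball p r)" for z
          using deriv by (rule has_derivative_at_withinI)
        show "onorm ((*v) (J t z) - (*v) (J t p)) \<le> e" if "z \<in> ball p r" for z
        proof -
          have "norm (J t z - J t p) \<le> e'"
            using d(2)[of z t] that by (simp add: r_def dist_norm norm_minus_commute)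
          then have "\<bar>(J t z - J t p) $ i $ j\<bar> \<le> e'" for i j
            using component_le_norm_cart[of "(J t z - J t p) $ i" j] Finite_Cartesian_Product.norm_nth_le[of "J t z - J t p" i]
            by linarith
          then have "onorm ((*v) (J t z - J t p)) \<le> real CARD('m) * real CARD('n) * e'"
            by (rule onorm_le_matrix_component)
          moreover have "(*v) (J t z) - (*v) (J t p) = (*v) (J t z - J t p)"
            by (auto simp: matrix_vector_mult_diff_rdistrib)
          ultimately show ?thesis by (simp add: e'_def)
        qed
        show "p \<in> ball p r" using d(1) by (simp add: r_def)
      qed
      then show ?thesis by (simp add: mult.commute)
    qed
    moreover have "r > 0" using d(1) by (simp add: r_def)
    ultimately show ?thesis by blast
  qed
  obtain d where d: "d > 0" "\<And>t x y. x \<in> ball p d \<Longrightarrow> y \<in> ball p d \<Longrightarrow>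
      norm (F t x - F t y - J t p *v (x - y)) \<le> 1 * norm (x - y)"
    using strict[of 1] by auto
  have "p \<in> cball p 1" "(0 :: real) < 1" by simp_all
  then obtain d' where d': "d' > 0"
    "\<And>t x. x \<in> cball p 1 \<Longrightarrow> dist x p < d' \<Longrightarrow> dist (F t x) (F t p) < 1"
    using F unfolding equicontinuous_on_def by meson
  define r where "r = min (min d d') 1 / 2"
  have r: "0 < r" "r < d" "r < d'" "r < 1"
    using d(1) d'(1) by (auto simp: r_def)
  have "norm (J t p *v v) \<le> (1 + r) / r * norm v" for t v
  proof (cases "v = 0")
    case False
    \<comment> \<open>Rescaled to length \<open>r\<close>, the vector gives an increment of
      \<open>F t\<close> below 1 and a remainder of at most \<open>r\<close>, whatever
      \<open>t\<close> is; homogeneity then bounds the derivative on \<open>v\<close>.\<close>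
    define w where "w = (r / norm v) *\<^sub>R v"
    have w: "norm w = r" using False r(1) by (simp add: w_def)
    have "norm (F t (p + w) - F t p) < 1"
      using d'(2)[of "p + w" t] w r by (simp add: dist_norm)
    moreover have "norm (F t (p + w) - F t p - J t p *v w) \<le> r"
      using d(2)[of "p + w" p t] w r by (simp add: dist_norm)
    ultimately have "norm (J t p *v w) \<le> 1 + r"
      using norm_triangle_sub[of "J t p *v w" "F t (p + w) - F t p"]
      by (simp add: norm_minus_commute)
    moreover have "norm (J t p *v w) = r / norm v * norm (J t p *v v)"
      using r(1) by (simp add: w_def matrix_vector_mult_scaleR)
    ultimately show ?thesis
      using False r(1) by (simp add: field_simps)
  qed simp
  then show ?thesis
    using strict unfolding uniformly_strictly_differentiable_def by (auto intro: exI[of _ "(1 + r) / r"])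
qed

text \<open>The chain rule along the diagonal orbit of \<open>s\<close> produces exactly the matrix
  products that enter \<open>transverse_diam\<close>.\<close>

lemma uniformly_strictly_differentiable_flow:
  fixes F :: "nat \<Rightarrow> real ^ 'm::finite \<Rightarrow> real ^ 'm"
  assumes diag: "\<And>t s. F t (vec s) = vec (f s)"
    and F: "\<And>s. uniformly_strictly_differentiable F (\<lambda>t. (*v) (D t s)) (vec s)"
  shows "uniformly_strictly_differentiable (\<lambda>t. flow F t n)
           (\<lambda>t. (*v) (left_prod (\<lambda>k. D k ((f ^^ (k - t)) s)) t n)) (vec s)"
proof (induction n)
  case 0
  show ?case
    by (auto simp: uniformly_strictly_differentiable_def linear_id[unfolded id_def] intro: exI[of _ 1])
next
  case (Suc n)
  \<comment> \<open>Shifting time is harmless because the bounds and radii do not depend on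
    \<open>t\<close>.\<close>
  have "uniformly_strictly_differentiable (\<lambda>t. F (t + n)) (\<lambda>t. (*v) (D (t + n) ((f ^^ n) s)))
      (vec ((f ^^ n) s))"
    using F[of "(f ^^ n) s"] unfolding uniformly_strictly_differentiable_def by meson
  from uniformly_strictly_differentiable_compose[OF Suc.IH flow_diagonal[of F f, OF diag] this]
  show ?case by (simp add: matrix_vector_mul_assoc)
qed

section \<open>Transverse contraction near a point of the attractor\<close>

text \<open>Provides the growth bounds at intermediate times: \<open>G t\<close> sends the diagonal
  point built from a component of \<open>x\<close> to the diagonal, so a Lipschitz bound for this
  pair controls the diameter of the image.\<close>

lemma hajnal_diam_lipschitz:
  fixes G :: "nat \<Rightarrow> real ^ 'm::finite \<Rightarrow> real ^ 'm"
  assumes G: "uniformly_strictly_differentiable G L (vec s)"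
    and diag: "\<And>t r. G t (vec r) = vec (g r)"
  obtains B d where "d > 0"
    "\<And>t x. dist x (vec s) < d \<Longrightarrow> hajnal_diam abs (G t x) \<le> B * hajnal_diam abs x"
proof -
  obtain B d where B: "B > 0" "d > 0"
    "\<And>t x y. x \<in> ball (vec s) d \<Longrightarrow> y \<in> ball (vec s) d \<Longrightarrow> norm (G t x - G t y) \<le> B * norm (x - y)"
    using uniformly_strictly_differentiable_lipschitz[OF G] by blast
  have "hajnal_diam abs (G t x) \<le> (2 * B * CARD('m)) * hajnal_diam abs x"
    \<comment> \<open>The smaller radius ensures that the diagonal point \<open>y\<close> lies in
      the ball of radius \<open>d\<close> too.\<close>
    if x: "dist x (vec s) < d / CARD('m)" for t x
  proof -
    define y :: "real ^ 'm" where "y = vec (x $ undefined)"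
    have "d / CARD('m) \<le> d" using B(2) by (simp add: field_simps)
    have "dist y (vec s) \<le> CARD('m) * dist (x $ undefined) s"
      unfolding y_def by (rule dist_vec_le)
    also have "\<dots> \<le> CARD('m) * dist x (vec s)"
      by (intro mult_left_mono dist_component_vec) simp
    also have "\<dots> < d" using x by (simp add: field_simps)
    finally have in_ball: "x \<in> ball (vec s) d" "y \<in> ball (vec s) d"
      using x \<open>d / CARD('m) \<le> d\<close> by (auto simp: dist_commute)
    have "hajnal_diam abs (G t x) \<le> 2 * norm (G t x - G t y)"
      using hajnal_diam_le_dist_vec[of "G t x" "g (x $ undefined)"] by (simp add: y_def diag dist_norm)
    also have "\<dots> \<le> 2 * (B * norm (x - y))"
      using B(3)[OF in_ball] by simp
    also have "\<dots> \<le> 2 * (B * (CARD('m) * hajnal_diam abs x))"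
      using B(1) dist_diag_le_hajnal_diam[of x undefined]
      by (intro mult_left_mono) (auto simp: y_def dist_norm)
    finally show ?thesis by (simp add: mult.assoc)
  qed
  then show ?thesis
    using B(2) by (intro that[of "d / CARD('m)" "2 * B * CARD('m)"]) auto
qed

text \<open>
  Only differences of rows of the linear part enter, because the map sends the diagonal to itself.
\<close>
lemma hajnal_diam_contraction:
  fixes G :: "nat \<Rightarrow> real ^ 'm::finite \<Rightarrow> real ^ 'm"
  assumes G: "uniformly_strictly_differentiable G (\<lambda>t. (*v) (P t)) (vec s)"
    and diag: "\<And>t r. G t (vec r) = vec (g r)"
    and c: "c > 0" "\<And>v. norm v \<le> c * N v"
    and P: "\<And>t. hajnal_diam N (P t) \<le> 1 / (4 * c * CARD('m))"
  obtains d where "d > 0"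
    "\<And>t x. dist x (vec s) < d \<Longrightarrow> hajnal_diam abs (G t x) \<le> hajnal_diam abs x / 2"
proof -
  \<comment> \<open>The remainder \<open>R\<close> is then at most 1/8 of the diameter; two of its
    components use 1/4, and the row differences of \<open>P t\<close> use the other 1/4.\<close>
  define e where "e = 1 / (8 * real CARD('m))"
  obtain d where d: "d > 0"
    "\<And>t x y. x \<in> ball (vec s) d \<Longrightarrow> y \<in> ball (vec s) d \<Longrightarrow>
       norm (G t x - G t y - P t *v (x - y)) \<le> e * norm (x - y)"
    using uniformly_strictly_differentiableD[OF G, of e] by (auto simp: e_def)
  have "hajnal_diam abs (G t x) \<le> hajnal_diam abs x / 2"
    if x: "dist x (vec s) < d / CARD('m)" for t x
  proof (rule hajnal_diam_le)
    fix i j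
    define y :: "real ^ 'm" where "y = vec (x $ undefined)"
    define w where "w = x - y"
    define R where "R = G t x - G t y - P t *v w"
    have "d / CARD('m) \<le> d" using d(1) by (simp add: field_simps)
    have "dist y (vec s) \<le> CARD('m) * dist (x $ undefined) s"
      unfolding y_def by (rule dist_vec_le)
    also have "\<dots> \<le> CARD('m) * dist x (vec s)"
      by (intro mult_left_mono dist_component_vec) simp
    also have "\<dots> < d" using x by (simp add: field_simps)
    finally have in_ball: "x \<in> ball (vec s) d" "y \<in> ball (vec s) d"
      using x \<open>d / CARD('m) \<le> d\<close> by (auto simp: dist_commute)
    have w: "norm w \<le> CARD('m) * hajnal_diam abs x"
      using dist_diag_le_hajnal_diam[of x undefined] by (simp add: w_def y_def dist_norm)
    have "norm R \<le> e * norm w"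
      unfolding R_def w_def by (rule d(2)[OF in_ball])
    also have "\<dots> \<le> e * (CARD('m) * hajnal_diam abs x)"
      using w by (intro mult_left_mono) (auto simp: e_def)
    finally have R: "norm R \<le> hajnal_diam abs x / 8"
      by (simp add: e_def)
    have rows: "\<bar>(P t $ i - P t $ j) \<bullet> w\<bar> \<le> hajnal_diam abs x / 4"
    proof -
      have "norm (P t $ i - P t $ j) \<le> c * N (P t $ i - P t $ j)"
        by (rule c(2))
      also have "\<dots> \<le> c * (1 / (4 * c * CARD('m)))"
        using c(1) order_trans[OF hajnal_diam_ge P] by (intro mult_left_mono) auto
      finally have "norm (P t $ i - P t $ j) \<le> 1 / (4 * CARD('m))"
        using c(1) by simp
      then have "norm (P t $ i - P t $ j) * norm w
          \<le> 1 / (4 * CARD('m)) * (CARD('m) * hajnal_diam abs x)"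
        using w by (intro mult_mono) auto
      then show ?thesis
        using Cauchy_Schwarz_ineq2[of "P t $ i - P t $ j" w] by simp
    qed
    have "G t x = vec (g (x $ undefined)) + P t *v w + R"
      by (simp add: R_def y_def diag)
    then have "G t x $ i - G t x $ j = (P t $ i - P t $ j) \<bullet> w + (R $ i - R $ j)"
      by (simp add: matrix_vector_mul_component inner_diff_left)
    then show "\<bar>G t x $ i - G t x $ j\<bar> \<le> hajnal_diam abs x / 2"
      using rows R component_le_norm_cart[of R i] component_le_norm_cart[of R j] by linarith
  qed
  then show ?thesis
    using that[of "d / CARD('m)"] d(1) by simp
qed

text \<open>A limit superior of n-th roots below 1 forces geometric decay. The supremum over start
  times is taken before the limit, so one \<open>n\<close> serves all \<open>t\<close>.\<close>

lemma transverse_diam_less_one: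
  fixes \<phi> :: "nat \<Rightarrow> 'm::finite \<Rightarrow> real ^ 'm \<Rightarrow> real"
  assumes "transverse_diam N f \<phi> s < 1" "vector_norm N" "\<epsilon> > 0"
  obtains n where "n \<ge> 1"
    "\<And>t. hajnal_diam N (left_prod (\<lambda>k. diagonal_jacobian \<phi> k ((f ^^ (k - t)) s)) t n) \<le> \<epsilon>"
proof -
  define h where "h t n = hajnal_diam N (left_prod (\<lambda>k. diagonal_jacobian \<phi> k ((f ^^ (k - t)) s)) t n)" for t n
  have "N 0 = 0"
    using assms(2) by (simp add: vector_norm_def)
  then have h_nonneg: "0 \<le> h t n" for t n
    using hajnal_diam_ge[of N _ undefined undefined] unfolding h_def by (metis diff_self)
  obtain r where r: "transverse_diam N f \<phi> s < ereal r" "ereal r < 1"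
    using ereal_dense2[OF assms(1)] by blast
  have root: "eventually (\<lambda>n. (SUP t. ereal (h t n powr (1 / real n))) < ereal r) sequentially"
    using Limsup_lessD[OF r(1)[unfolded transverse_diam_def]] by (simp add: h_def)
  have bound: "h t n \<le> r ^ n \<and> 0 < r" if "(SUP t. ereal (h t n powr (1 / real n))) < ereal r" "n \<ge> 1" for t n
  proof -
    have "ereal (h t n powr (1 / real n)) < ereal r"
      using that(1) by (rule le_less_trans[OF SUP_upper[OF UNIV_I]])
    then have less: "h t n powr (1 / real n) < r" by simp
    then have "0 < r" using powr_ge_zero le_less_trans by blast
    moreover have "h t n = (h t n powr (1 / real n)) ^ n"
      using that(2) h_nonneg[of t n] by (cases "h t n = 0") (auto simp: powr_powr simp flip: powr_realpow)
    ultimately show ?thesis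
      using less power_mono[of "h t n powr (1 / real n)" r n] by simp
  qed
  \<comment> \<open>A real below 1 could be very negative; exceeding some nonnegative root makes
    \<open>r\<close> positive, so its powers tend to 0.\<close>
  have "0 < r"
    using eventually_conj[OF root eventually_ge_at_top[of 1]] bound
    by (metis (mono_tags, lifting) eventually_happens' sequentially_bot)
  then have "(\<lambda>n. r ^ n) \<longlonglongrightarrow> 0"
    using r(2) by (intro LIMSEQ_power_zero) simp
  then have "eventually (\<lambda>n. r ^ n < \<epsilon>) sequentially"
    using assms(3) by (rule order_tendstoD(2))
  then have "eventually (\<lambda>n. r ^ n < \<epsilon> \<and> (SUP t. ereal (h t n powr (1 / real n))) < ereal r \<and> n \<ge> 1) sequentially"
    using root eventually_ge_at_top[of 1] by (simp add: eventually_conj_iff)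
  then obtain n where "r ^ n < \<epsilon>" "(SUP t. ereal (h t n powr (1 / real n))) < ereal r" "n \<ge> 1"
    using eventually_happens' sequentially_bot by (metis (mono_tags, lifting))
  then show ?thesis
    using that[of n] bound[of n] unfolding h_def by (meson less_imp_le order_trans)
qed

lemma flow_contraction_at_point:
  fixes \<phi> :: "nat \<Rightarrow> 'm::finite \<Rightarrow> real ^ 'm \<Rightarrow> real"
  assumes diag: "\<And>t r. F t (vec r) = vec (f r)"
    and F: "\<And>r. uniformly_strictly_differentiable F (\<lambda>t. (*v) (diagonal_jacobian \<phi> t r)) (vec r)"
    and N: "vector_norm N" and transverse: "transverse_diam N f \<phi> s < 1"
  shows "\<exists>n\<ge>1. \<exists>C. \<exists>d>0. \<forall>x. dist x (vec s) < d \<longrightarrow> (\<forall>t.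
      hajnal_diam abs (flow F t n x) \<le> hajnal_diam abs x / 2 \<and>
      (\<forall>k\<le>n. hajnal_diam abs (flow F t k x) \<le> C * hajnal_diam abs x))"
proof -
  obtain c where c: "c > 0" "\<And>v. norm v \<le> c * N v"
    using vector_norm_bound[OF N] by blast
  obtain n where n: "n \<ge> 1" "\<And>t. hajnal_diam N
      (left_prod (\<lambda>k. diagonal_jacobian \<phi> k ((f ^^ (k - t)) s)) t n) \<le> 1 / (4 * c * CARD('m))"
    using transverse_diam_less_one[OF transverse N, of "1 / (4 * c * CARD('m))"] c(1) by auto
  note flow = uniformly_strictly_differentiable_flow[OF diag F, of _ s]
  obtain d where d: "d > 0"
    "\<And>t x. dist x (vec s) < d \<Longrightarrow> hajnal_diam abs (flow F t n x) \<le> hajnal_diam abs x / 2"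
    using hajnal_diam_contraction[OF flow flow_diagonal[of F f, OF diag] c n(2)] by blast
  have "\<exists>B e. e > 0 \<and> (\<forall>t x. dist x (vec s) < e \<longrightarrow>
      hajnal_diam abs (flow F t k x) \<le> B * hajnal_diam abs x)" for k
    using hajnal_diam_lipschitz[OF flow[of k] flow_diagonal[of F f, OF diag]] by metis
  then obtain B e where Be: "\<And>k. e k > 0"
    "\<And>k t x. dist x (vec s) < e k \<Longrightarrow> hajnal_diam abs (flow F t k x) \<le> B k * hajnal_diam abs x"
    by metis
  define r where "r = min d (Min (e ` {..n}))"
  define C where "C = (\<Sum>k\<le>n. \<bar>B k\<bar>)"
  have "r > 0" using d(1) Be(1) by (simp add: r_def)
  moreover have "hajnal_diam abs (flow F t n x) \<le> hajnal_diam abs x / 2" if "dist x (vec s) < r" for t x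
    using d(2) that by (simp add: r_def)
  moreover have "hajnal_diam abs (flow F t k x) \<le> C * hajnal_diam abs x"
    if "dist x (vec s) < r" "k \<le> n" for t x k
  proof -
    have "dist x (vec s) < e k" using that by (simp add: r_def)
    then have "hajnal_diam abs (flow F t k x) \<le> B k * hajnal_diam abs x" by (rule Be(2))
    also have "\<dots> \<le> C * hajnal_diam abs x"
    proof (rule mult_right_mono)
      have "B k \<le> \<bar>B k\<bar>" by simp
      also have "\<dots> \<le> C" unfolding C_def by (rule member_le_sum) (use that(2) in auto)
      finally show "B k \<le> C" .
    qed (rule hajnal_diam_abs_nonneg)
    finally show ?thesis .
  qed
  ultimately show ?thesis using n(1) by blast
qed

text \<open>Finitely many of the local balls cover the compact diagonal copy of \<open>A\<close>,
  and so does their union a whole \<open>\<delta>\<close>-neighbourhood of it. The length still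
  depends on the ball containing \<open>x\<close>.\<close>

lemma uniform_flow_contraction:
  fixes F :: "nat \<Rightarrow> real ^ 'm::finite \<Rightarrow> real ^ 'm"
  assumes "compact A" "A \<noteq> {}"
    and local: "\<And>s. s \<in> A \<Longrightarrow> \<exists>n\<ge>1. \<exists>C. \<exists>d>0. \<forall>x. dist x (vec s) < d \<longrightarrow> (\<forall>t.
      hajnal_diam abs (flow F t n x) \<le> hajnal_diam abs x / 2 \<and>
      (\<forall>k\<le>n. hajnal_diam abs (flow F t k x) \<le> C * hajnal_diam abs x))"
  obtains \<delta> C M where "\<delta> > 0" "C \<ge> 1"
    "\<And>x. infdist x (vec ` A) < \<delta> \<Longrightarrow>
      \<exists>n. 1 \<le> n \<and> n \<le> M \<and> (\<forall>t. hajnal_diam abs (flow F t n x) \<le> hajnal_diam abs x / 2 \<and>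
        (\<forall>k\<le>n. hajnal_diam abs (flow F t k x) \<le> C * hajnal_diam abs x))"
proof -
  obtain n C d where *: "\<And>s. s \<in> A \<Longrightarrow> n s \<ge> (1 :: nat)" "\<And>s. s \<in> A \<Longrightarrow> d s > 0"
    "\<And>s x t. s \<in> A \<Longrightarrow> dist x (vec s) < d s \<Longrightarrow> hajnal_diam abs (flow F t (n s) x) \<le> hajnal_diam abs x / 2"
    "\<And>s x t k. s \<in> A \<Longrightarrow> dist x (vec s) < d s \<Longrightarrow> k \<le> n s \<Longrightarrow>
       hajnal_diam abs (flow F t k x) \<le> C s * hajnal_diam abs x"
    using local by metis
  have cover: "vec ` A \<subseteq> (\<Union>s\<in>A. ball (vec s :: real ^ 'm) (d s))"
    using *(2) by auto
  obtain D where D: "D \<subseteq> A" "finite D" "vec ` A \<subseteq> (\<Union>s\<in>D. ball (vec s :: real ^ 'm) (d s))"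
    by (rule compactE_image[OF compact_vec_image[OF assms(1)] _ cover]) auto
  have "open (\<Union>s\<in>D. ball (vec s :: real ^ 'm) (d s))"
    by blast
  from compact_subset_open_imp_ball_epsilon_subset[OF compact_vec_image[OF assms(1)] this D(3)]
  obtain \<delta> where \<delta>: "\<delta> > 0"
    "(\<Union>x\<in>vec ` A. ball x \<delta>) \<subseteq> (\<Union>s\<in>D. ball (vec s :: real ^ 'm) (d s))"
    by blast
  \<comment> \<open>Sums over the finite subcover stand in for maxima; the summand 1 secures
    \<open>C' \<ge> 1\<close>.\<close>
  define C' where "C' = 1 + (\<Sum>s\<in>D. \<bar>C s\<bar>)"
  have "C' \<ge> 1" by (simp add: C'_def sum_nonneg)
  moreover have "\<exists>p. 1 \<le> p \<and> p \<le> sum n D \<and> (\<forall>t. hajnal_diam abs (flow F t p x) \<le> hajnal_diam abs x / 2 \<and>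
        (\<forall>k\<le>p. hajnal_diam abs (flow F t k x) \<le> C' * hajnal_diam abs x))"
    if x: "infdist x (vec ` A) < \<delta>" for x
  proof -
    obtain a where "a \<in> A" "dist x (vec a) < \<delta>"
      using x assms(2) by (auto simp: infdist_less_iff)
    then have "x \<in> (\<Union>x\<in>vec ` A. ball x \<delta>)"
      by (auto simp: dist_commute)
    then have "x \<in> (\<Union>s\<in>D. ball (vec s) (d s))"
      using \<delta>(2) by (rule subsetD[rotated])
    then obtain s where s: "s \<in> D" "dist x (vec s) < d s"
      by (auto simp: dist_commute)
    then have "s \<in> A" using D(1) by blast
    have "C s \<le> \<bar>C s\<bar>" by simp
    also have "\<dots> \<le> (\<Sum>s\<in>D. \<bar>C s\<bar>)" by (rule member_le_sum) (use s D(2) in auto)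
    finally have "C s * hajnal_diam abs x \<le> C' * hajnal_diam abs x"
      by (intro mult_right_mono hajnal_diam_abs_nonneg) (simp add: C'_def)
    moreover have "n s \<le> sum n D" by (rule member_le_sum) (use s D(2) in auto)
    ultimately show ?thesis
      using *(1,3,4)[OF \<open>s \<in> A\<close>] s(2) by (meson order_trans)
  qed
  ultimately show ?thesis
    using that \<delta>(1) by blast
qed

section \<open>The coupled system\<close>

text \<open>\<open>jacobian\<close> rests on a choice of derivative and is informative only once
  differentiability is known, which is obtained here from the components.\<close>

lemma coupled_map_has_derivative:
  assumes "\<And>i. C1_map (\<phi> t i)"
  shows "(coupled_map \<phi> t has_derivative (*v) (jacobian (coupled_map \<phi> t) (at x))) (at x)"
proof -
  have "(\<lambda>x. coupled_map \<phi> t x \<bullet> b) differentiable at x" if b: "b \<in> Basis" for b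
  proof -
    obtain i where "b = axis i 1"
      using b by (auto simp: Basis_vec_def)
    then have "(\<lambda>x. coupled_map \<phi> t x \<bullet> b) = \<phi> t i"
      by (simp add: coupled_map_def inner_axis)
    then show ?thesis
      using assms[of i] by (auto simp: C1_map_def differentiable_def)
  qed
  then have "coupled_map \<phi> t differentiable at x"
    using differentiable_componentwise_within[of "coupled_map \<phi> t" x UNIV] by simp
  then show ?thesis
    by (simp add: jacobian_works)
qed

lemma coupled_map_equicontinuous:
  fixes \<phi> :: "nat \<Rightarrow> 'm::finite \<Rightarrow> real ^ 'm \<Rightarrow> real"
  assumes "\<And>i. equicontinuous_on K (\<lambda>t. \<phi> t i)"
  shows "equicontinuous_on K (coupled_map \<phi>)"
  unfolding equicontinuous_on_def
proof (intro ballI allI impI)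
  fix x and \<epsilon> :: real
  assume "x \<in> K" "\<epsilon> > 0"
  define e where "e = \<epsilon> / (2 * CARD('m))"
  have "e > 0" using \<open>\<epsilon> > 0\<close> by (simp add: e_def)
  then have "\<forall>i. \<exists>\<delta>>0. \<forall>t. \<forall>y\<in>K. dist y x < \<delta> \<longrightarrow> dist (\<phi> t i y) (\<phi> t i x) < e"
    using assms \<open>x \<in> K\<close> unfolding equicontinuous_on_def by blast
  then obtain \<delta> where \<delta>: "\<And>i. \<delta> i > 0"
    "\<And>i t y. y \<in> K \<Longrightarrow> dist y x < \<delta> i \<Longrightarrow> dist (\<phi> t i y) (\<phi> t i x) < e"
    by metis
  have "dist (coupled_map \<phi> t y) (coupled_map \<phi> t x) < \<epsilon>"
    if y: "y \<in> K" "dist y x < Min (range \<delta>)" for t y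
  proof -
    have "\<bar>\<phi> t i y - \<phi> t i x\<bar> \<le> e" for i
      using \<delta>(2)[of y i t] y by (simp add: dist_real_def less_imp_le)
    \<comment> \<open>Subtracting \<open>vec 0\<close> brings the difference into the form of
      \<open>norm_diff_vec_le\<close>.\<close>
    then have "norm (coupled_map \<phi> t y - coupled_map \<phi> t x - vec 0) \<le> CARD('m) * e"
      by (intro norm_diff_vec_le) (simp add: coupled_map_def)
    also have "\<dots> < \<epsilon>" using \<open>\<epsilon> > 0\<close> by (simp add: e_def)
    finally show ?thesis by (simp add: dist_norm)
  qed
  moreover have "Min (range \<delta>) > 0" using \<delta>(1) by simp
  ultimately show "\<exists>\<delta>>0. \<forall>t. \<forall>y\<in>K. dist y x < \<delta> \<longrightarrow>
      dist (coupled_map \<phi> t y) (coupled_map \<phi> t x) < \<epsilon>" by blast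
qed

theorem theorem1:
  fixes \<phi> :: "nat \<Rightarrow> 'm::finite \<Rightarrow> real ^ 'm \<Rightarrow> real"
    and f :: "real \<Rightarrow> real"
    and A :: "real set"
    and N :: "real ^ 'm \<Rightarrow> real"
  assumes C1: "\<And>t i. C1_map (\<phi> t i)"
    and f_C1: "f C1_differentiable_on UNIV"
    and diagonal: "\<And>t i s. \<phi> t i (vec s) = f s"
    and equicont: "\<And>K i. compact K \<Longrightarrow> equicontinuous_on K (\<lambda>t. \<phi> t i)"
    and equicont_jacobian:
      "\<And>K. compact K \<Longrightarrow> equicontinuous_on K (\<lambda>t x. jacobian (coupled_map \<phi> t) (at x))"
    and nonsingular:
      "\<And>K t x. compact K \<Longrightarrow> x \<in> K \<Longrightarrow> invertible (jacobian (coupled_map \<phi> t) (at x))"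
    and attractor: "asymptotically_stable_attractor f A"
    and norm: "vector_norm N"
    and transverse: "(SUP s\<^sub>0\<in>A. transverse_diam N f \<phi> s\<^sub>0) < 1"
  shows "uniformly_asymptotically_stable_attractor (coupled_map \<phi>)
           (cartesian_power A \<inter> synchronization_manifold)
       \<and> uniformly_locally_synchronized (coupled_map \<phi>) f A"
proof -
  have A: "compact A" "A \<noteq> {}"
    using attractor by (auto simp: asymptotically_stable_attractor_def)
  have diag: "coupled_map \<phi> t (vec r) = vec (f r)" for t r
    by (simp add: coupled_map_def diagonal vec_eq_iff)
  have equicontinuous: "equicontinuous_on K (coupled_map \<phi>)" if "compact K" for K
    by (intro coupled_map_equicontinuous equicont that)
  have strict: "uniformly_strictly_differentiable (coupled_map \<phi>)
      (\<lambda>t. (*v) (diagonal_jacobian \<phi> t r)) (vec r)" for r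
    unfolding diagonal_jacobian_def
    by (intro uniformly_strictly_differentiable_equicontinuous coupled_map_has_derivative C1
        equicontinuous equicont_jacobian) auto
  have "transverse_diam N f \<phi> s < 1" if "s \<in> A" for s
    using transverse SUP_upper[OF that] by (rule le_less_trans[rotated])
  then obtain \<delta> C M where \<delta>: "\<delta> > 0" "C \<ge> 1" "\<And>x. infdist x (vec ` A) < \<delta> \<Longrightarrow>
      \<exists>n. 1 \<le> n \<and> n \<le> M \<and> (\<forall>t. hajnal_diam abs (flow (coupled_map \<phi>) t n x) \<le> hajnal_diam abs x / 2 \<and>
        (\<forall>k\<le>n. hajnal_diam abs (flow (coupled_map \<phi>) t k x) \<le> C * hajnal_diam abs x))"
    using uniform_flow_contraction[OF A flow_contraction_at_point[OF diag strict norm]] by metis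
  have cont: "continuous_on UNIV f"
    using f_C1 by (rule C1_differentiable_imp_continuous_on)
  interpret diagonal_contraction "coupled_map \<phi>" f A \<delta> C M
    using attractor flow_tracks_diagonal[OF diag cont equicontinuous] \<delta> by unfold_locales
  show ?thesis
    unfolding cartesian_power_Int_synchronization_manifold by (rule synchronization)
qed

end
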